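(* Let $P$ be a right-angled polygonal billiard table in the plane with all edges horizontal or vertical, let $a,b>0$, and let $P'$ be the image of $P$ under the linear map $\begin{pmatrix} a&0\\0&b\end{pmatrix}$ (up to translation), with each edge of $P'$ carrying the label of the corresponding edge of $P$. Then $P$ and $P'$ have the same bounce spectrum: $B(P)=B(P')$.
   Context: A billiard table is right-angled if all of its interior angles are $\pi/2$ or $3\pi/2$. The edges of a polygon $P$ are labeled by distinct letters of a finite alphabet $\mathcal{A}$. A billiard trajectory moves along straight lines in $P$ and reflects optically (angle of incidence equals angle of reflection) at interior points of edges; it is singular if it ever hits a vertex. The bounce sequence of a nonsingular bi-infinite (basepointed) trajectory is the $\mathbb{Z}$-indexed sequence of labels of the edges it hits, and the bounce spectrum $B(P)\subset\mathcal{A}^{\mathbb{Z}}$ is the set of bounce sequences of all nonsingular trajectories on $P$. *)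

theory Defs
  imports "HOL-Analysis.Analysis"
begin

text \<open>The plane is identified with \<^typ>\<open>complex\<close>. A polygon is given by the cyclic list of its
  vertices; edge number \<open>i\<close> joins vertex \<open>i\<close> to vertex \<open>i + 1\<close> (cyclically).\<close>

definition next_vertex :: "complex list \<Rightarrow> nat \<Rightarrow> complex" where
  "next_vertex V i = V ! (Suc i mod length V)"

definition edge :: "complex list \<Rightarrow> nat \<Rightarrow> complex set" where
  "edge V i = closed_segment (V ! i) (next_vertex V i)"

definition edge_interior :: "complex list \<Rightarrow> nat \<Rightarrow> complex set" where
  "edge_interior V i = open_segment (V ! i) (next_vertex V i)"

definition boundary :: "complex list \<Rightarrow> complex set" where
  "boundary V = (\<Union>i<length V. edge V i)"

text \<open>Two distinct edges meet only in common endpoints, so the boundary is a Jordan curve.\<close>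

definition polygon :: "complex list \<Rightarrow> bool" where
  "polygon V \<longleftrightarrow> 3 \<le> length V \<and> distinct V \<and>
     (\<forall>i<length V. \<forall>j<length V. i \<noteq> j \<longrightarrow>
        edge V i \<inter> edge V j = {V ! i, next_vertex V i} \<inter> {V ! j, next_vertex V j})"

definition table :: "complex list \<Rightarrow> complex set" where
  "table V = boundary V \<union> inside (boundary V)"

text \<open>Near \<open>v\<close> the set \<open>S\<close> is a circular sector of opening angle \<open>\<theta>\<close> with apex \<open>v\<close>.\<close>

definition has_interior_angle :: "complex set \<Rightarrow> complex \<Rightarrow> real \<Rightarrow> bool" where
  "has_interior_angle S v \<theta> \<longleftrightarrow> 0 < \<theta> \<and> \<theta> < 2 * pi \<and>
     (\<exists>\<phi>. \<exists>r>0. S \<inter> ball v r =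
        {v + complex_of_real s * cis (\<phi> + t) | s t. 0 \<le> s \<and> s < r \<and> 0 \<le> t \<and> t \<le> \<theta>})"

definition right_angled :: "complex list \<Rightarrow> bool" where
  "right_angled V \<longleftrightarrow> (\<forall>v\<in>set V.
     has_interior_angle (table V) v (pi / 2) \<or> has_interior_angle (table V) v (3 * pi / 2))"

definition axis_parallel :: "complex list \<Rightarrow> bool" where
  "axis_parallel V \<longleftrightarrow> (\<forall>i<length V.
     Re (V ! i) = Re (next_vertex V i) \<or> Im (V ! i) = Im (next_vertex V i))"

text \<open>Orthogonal reflection in the line spanned by \<open>d\<close>.\<close>

definition reflect :: "complex \<Rightarrow> complex \<Rightarrow> complex" where
  "reflect d u = (2 * (u \<bullet> d) / (d \<bullet> d)) *\<^sub>R d - u"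

text \<open>A unit-speed motion defined for all times, which is straight inside the table, is reflected
  at interior points of edges and never meets a vertex. Motion along an edge needs no separate
  exclusion: it is not deflected by the reflection, hence would run into a vertex.\<close>

definition nonsingular_trajectory :: "complex list \<Rightarrow> (real \<Rightarrow> complex) \<Rightarrow> bool" where
  "nonsingular_trajectory V \<gamma> \<longleftrightarrow>
     (\<forall>t. \<gamma> t \<in> table V \<and> \<gamma> t \<notin> set V) \<and>
     (\<forall>t. \<gamma> t \<in> inside (boundary V) \<longrightarrow>
        (\<exists>u. norm u = 1 \<and> (\<exists>\<epsilon>>0. \<forall>s. \<bar>s\<bar> < \<epsilon> \<longrightarrow> \<gamma> (t + s) = \<gamma> t + s *\<^sub>R u))) \<and>
     (\<forall>t. \<forall>i<length V. \<gamma> t \<in> edge_interior V i \<longrightarrow>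
        (\<exists>u. norm u = 1 \<and> (\<exists>\<epsilon>>0. \<forall>s. 0 \<le> s \<and> s < \<epsilon> \<longrightarrow>
           \<gamma> (t - s) = \<gamma> t - s *\<^sub>R u \<and>
           \<gamma> (t + s) = \<gamma> t + s *\<^sub>R reflect (next_vertex V i - V ! i) u)))"

text \<open>\<open>ls ! i\<close> is the label of edge \<open>i\<close>. The basepoint of the trajectory is its position at time
  \<open>0\<close>; \<open>\<tau> k\<close> is the time of the \<open>k\<close>-th bounce, where the bounces are counted so that number \<open>0\<close>
  is the first one at or after the basepoint.\<close>

definition bounce_sequence ::
  "complex list \<Rightarrow> 'a list \<Rightarrow> (real \<Rightarrow> complex) \<Rightarrow> (int \<Rightarrow> 'a) \<Rightarrow> bool" where
  "bounce_sequence V ls \<gamma> w \<longleftrightarrow>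
     (\<exists>\<tau> :: int \<Rightarrow> real. strict_mono \<tau> \<and> range \<tau> = {t. \<gamma> t \<in> boundary V} \<and>
        \<tau> (- 1) < 0 \<and> 0 \<le> \<tau> 0 \<and>
        (\<forall>k. \<exists>i<length V. \<gamma> (\<tau> k) \<in> edge_interior V i \<and> w k = ls ! i))"

definition bounce_spectrum :: "complex list \<Rightarrow> 'a list \<Rightarrow> (int \<Rightarrow> 'a) set" where
  "bounce_spectrum V ls = {w. \<exists>\<gamma>. nonsingular_trajectory V \<gamma> \<and> bounce_sequence V ls \<gamma> w}"

text \<open>The linear map with matrix \<open>diag(a, b)\<close>, followed by the translation by \<open>c\<close>.\<close>

definition stretch :: "real \<Rightarrow> real \<Rightarrow> complex \<Rightarrow> complex \<Rightarrow> complex" where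
  "stretch a b c z = Complex (a * Re z) (b * Im z) + c"

text \<open>The polygon on the image vertices has the image region as its table, edge by edge.\<close>

lemma stretch_affine: "stretch a b c z = stretch a b 0 z + c"
  by (simp add: stretch_def)

lemma linear_stretch: "linear (stretch a b 0)"
  by (rule linearI) (auto simp: stretch_def complex_eq_iff algebra_simps)

lemma image_stretch: "stretch a b c ` S = (+) c ` (stretch a b 0 ` S)"
  by (auto simp: image_image stretch_affine[of a b c] add.commute)

lemma edge_stretch:
  assumes "i < length V"
  shows "edge (map (stretch a b c) V) i = stretch a b c ` edge V i"
proof -
  have "Suc i mod length V < length V"
    using assms by (intro mod_less_divisor) auto
  then have "edge (map (stretch a b c) V) i =
      closed_segment (c + stretch a b 0 (V ! i)) (c + stretch a b 0 (next_vertex V i))"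
    using assms by (simp add: edge_def next_vertex_def stretch_affine[of a b c] add.commute)
  also have "\<dots> = (+) c ` (stretch a b 0 ` edge V i)"
    by (simp add: closed_segment_translation closed_segment_linear_image[OF linear_stretch]
        edge_def)
  finally show ?thesis
    by (simp only: image_stretch[of a b c])
qed

lemma boundary_stretch: "boundary (map (stretch a b c) V) = stretch a b c ` boundary V"
  by (simp add: boundary_def edge_stretch image_UN)

lemma continuous_on_stretch: "continuous_on S (stretch a b c)"
  unfolding stretch_def[abs_def] Complex_eq by (intro continuous_intros)

lemma bounded_stretch: "bounded S \<Longrightarrow> bounded (stretch a b c ` S)"
  unfolding image_stretch[of a b c]
  by (intro bounded_translation bounded_linear_image)
    (auto simp: linear_conv_bounded_linear[symmetric] linear_stretch)

lemma stretch_inverse: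
  assumes "a \<noteq> 0" "b \<noteq> 0"
  shows "stretch (1/a) (1/b) (- stretch (1/a) (1/b) 0 c) (stretch a b c z) = z"
  using assms by (simp add: stretch_def complex_eq_iff field_simps)

lemma inside_stretch_subset:
  assumes "a \<noteq> 0" "b \<noteq> 0"
  shows "stretch a b c ` inside S \<subseteq> inside (stretch a b c ` S)"
proof safe
  define f where "f = stretch a b c"
  define g where "g = stretch (1/a) (1/b) (- stretch (1/a) (1/b) 0 c)"
  have gf: "g (f z) = z" for z
    using stretch_inverse[OF assms] by (simp add: f_def g_def)
  have fg: "f (g z) = z" for z
    using assms by (simp add: f_def g_def stretch_def complex_eq_iff field_simps)
  fix x assume x: "x \<in> inside S"
  let ?C = "connected_component_set (- (f ` S)) (f x)"
  have nx: "x \<notin> S" and bd: "bounded (connected_component_set (- S) x)"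
    using x by (auto simp: inside_def)
  have nfx: "f x \<notin> f ` S"
    using nx gf by (metis imageE)
  have "connected (g ` ?C)"
    unfolding g_def
    by (intro connected_continuous_image continuous_on_stretch connected_connected_component)
  moreover have "x \<in> g ` ?C"
    using gf nfx by (metis connected_component_refl_eq Compl_iff image_eqI mem_Collect_eq)
  moreover have "g ` ?C \<subseteq> - S"
  proof -
    have "g y \<notin> S" if "y \<in> ?C" for y
    proof -
      have "y \<in> - (f ` S)"
        using that connected_component_subset by blast
      then show ?thesis
        using fg by (metis ComplD image_eqI)
    qed
    then show ?thesis by auto
  qed
  ultimately have sub: "g ` ?C \<subseteq> connected_component_set (- S) x"
    by (intro connected_component_maximal)
  have "?C = f ` (g ` ?C)"
    by (simp add: image_image fg)
  also have "\<dots> \<subseteq> f ` connected_component_set (- S) x"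
    using sub by (rule image_mono)
  finally have "bounded ?C"
    using bd bounded_stretch f_def bounded_subset by metis
  then show "stretch a b c x \<in> inside (stretch a b c ` S)"
    using nfx by (simp add: inside_def f_def)
qed

lemma inside_stretch:
  assumes "a \<noteq> 0" "b \<noteq> 0"
  shows "inside (stretch a b c ` S) = stretch a b c ` inside S"
proof
  define c' where "c' = - stretch (1/a) (1/b) 0 c"
  have inv1: "stretch (1/a) (1/b) c' (stretch a b c z) = z" for z
    using stretch_inverse[OF assms] by (simp add: c'_def)
  have inv2: "stretch a b c (stretch (1/a) (1/b) c' z) = z" for z
    using assms by (simp add: c'_def stretch_def complex_eq_iff field_simps)
  have "stretch (1/a) (1/b) c' ` inside (stretch a b c ` S)
      \<subseteq> inside (stretch (1/a) (1/b) c' ` stretch a b c ` S)"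
    using assms by (intro inside_stretch_subset) auto
  then have "stretch (1/a) (1/b) c' ` inside (stretch a b c ` S) \<subseteq> inside S"
    by (simp add: image_image inv1)
  then show "inside (stretch a b c ` S) \<subseteq> stretch a b c ` inside S"
    using inv2 by (metis image_eqI image_subset_iff subsetI)
qed (rule inside_stretch_subset[OF assms])

lemma table_stretch:
  assumes "a \<noteq> 0" "b \<noteq> 0"
  shows "table (map (stretch a b c) V) = stretch a b c ` table V"
  by (simp add: table_def boundary_stretch inside_stretch[OF assms] image_Un)

end

theory Submission
  imports Defs
begin

text \<open>Reflection in an axis-parallel line only changes the sign of one coordinate of the velocity,
  so the absolute values of both coordinates are constant along a trajectory. Hence \<open>diag(a, b)\<close>
  maps the trajectory to a path of constant speed \<open>k\<close>, which still obeys the reflection law because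
  \<open>diag(a, b)\<close> commutes with the reflections in the two axis directions. Running this path with time
  divided by \<open>k\<close> gives a trajectory of the stretched table with the same bounces.\<close>

section \<open>Affine algebra of \<open>stretch\<close> and its action on edges\<close>

lemma stretch_add_scaleR: "stretch a b c (z + r *\<^sub>R u) = stretch a b c z + r *\<^sub>R stretch a b 0 u"
  by (simp add: stretch_def complex_eq_iff algebra_simps)

lemma stretch_diff_scaleR: "stretch a b c (z - r *\<^sub>R u) = stretch a b c z - r *\<^sub>R stretch a b 0 u"
  using stretch_add_scaleR[of a b c z "- r" u] by simp

lemma stretch_diff: "stretch a b c z - stretch a b c z' = stretch a b 0 (z - z')"
  by (simp add: stretch_def complex_eq_iff algebra_simps)

lemma inj_stretch: "a \<noteq> 0 \<Longrightarrow> b \<noteq> 0 \<Longrightarrow> inj (stretch a b c)"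
  by (auto simp: inj_def stretch_def complex_eq_iff)

lemma stretch_eq_0_iff: "a \<noteq> 0 \<Longrightarrow> b \<noteq> 0 \<Longrightarrow> stretch a b 0 u = 0 \<longleftrightarrow> u = 0"
  by (auto simp: stretch_def complex_eq_iff)

lemma next_vertex_map:
  assumes "i < length V"
  shows "next_vertex (map f V) i = f (next_vertex V i)"
proof -
  have "Suc i mod length V < length V"
    using assms by (intro mod_less_divisor) auto
  then show ?thesis
    by (simp add: next_vertex_def)
qed

lemma next_vertex_in_set: "i < length V \<Longrightarrow> next_vertex V i \<in> set V"
  unfolding next_vertex_def by (intro nth_mem mod_less_divisor) auto

lemma edge_interior_stretch:
  assumes "i < length V" "a \<noteq> 0" "b \<noteq> 0"
  shows "edge_interior (map (stretch a b c) V) i = stretch a b c ` edge_interior V i"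
proof -
  have "edge_interior W i = edge W i - {W ! i, next_vertex W i}" for W
    by (simp add: edge_interior_def edge_def open_segment_def)
  then show ?thesis
    using assms by (simp add: edge_stretch next_vertex_map image_set_diff inj_stretch)
qed

lemma axis_parallel_stretch: "axis_parallel V \<Longrightarrow> axis_parallel (map (stretch a b c) V)"
  by (auto simp: axis_parallel_def next_vertex_map) (auto simp: stretch_def)

text \<open>A nonsingular trajectory avoids all vertices, so this turns each of its boundary points
  into one where the reflection clause applies.\<close>

lemma boundary_diff_vertices:
  assumes "z \<in> boundary V" "z \<notin> set V"
  obtains i where "i < length V" "z \<in> edge_interior V i"
proof -
  from assms(1) obtain i where i: "i < length V" "z \<in> edge V i"
    by (auto simp: boundary_def)
  moreover have "z \<noteq> V ! i" "z \<noteq> next_vertex V i"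
    using assms(2) i(1) next_vertex_in_set by auto
  ultimately show ?thesis
    using that by (simp add: edge_interior_def edge_def open_segment_def)
qed

section \<open>Reflections in axis-parallel lines\<close>

text \<open>In coordinates, \<open>- cnj u\<close> flips only the real part. For
  \<open>d = 0\<close> the division by \<open>d \<bullet> d\<close> would instead yield the default
  value \<open>- u\<close>.\<close>

lemma reflect_vertical: "Re d = 0 \<Longrightarrow> d \<noteq> 0 \<Longrightarrow> reflect d u = - cnj u"
  by (auto simp: reflect_def inner_complex_def complex_eq_iff)

lemma reflect_horizontal: "Im d = 0 \<Longrightarrow> d \<noteq> 0 \<Longrightarrow> reflect d u = cnj u"
  by (auto simp: reflect_def inner_complex_def complex_eq_iff)

text \<open>Diagonal maps preserve both axis directions and commute with a sign change of one
  coordinate; for slanted \<open>d\<close> this fails in general. The factor \<open>r\<close> leaves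
  room for the later rescaling of time.\<close>

lemma reflect_stretch:
  assumes "Re d = 0 \<or> Im d = 0" "d \<noteq> 0" "a \<noteq> 0" "b \<noteq> 0"
  shows "reflect (stretch a b 0 d) (r *\<^sub>R stretch a b 0 u) = r *\<^sub>R stretch a b 0 (reflect d u)"
  using assms(1)
proof
  assume "Re d = 0"
  moreover from this have "Re (stretch a b 0 d) = 0"
    by (simp add: stretch_def)
  ultimately show ?thesis
    using assms by (simp add: reflect_vertical stretch_eq_0_iff) (simp add: stretch_def complex_eq_iff)
next
  assume "Im d = 0"
  moreover from this have "Im (stretch a b 0 d) = 0"
    by (simp add: stretch_def)
  ultimately show ?thesis
    using assms by (simp add: reflect_horizontal stretch_eq_0_iff) (simp add: stretch_def complex_eq_iff)
qed

text \<open>A sign change of one coordinate survives the stretch as a sign change, so the speed of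
  the image path is the same before and after a bounce.\<close>

lemma norm_stretch_reflect:
  assumes "Re d = 0 \<or> Im d = 0" "d \<noteq> 0"
  shows "norm (stretch a b 0 (reflect d u)) = norm (stretch a b 0 u)"
  using assms by (auto simp: reflect_vertical reflect_horizontal stretch_def cmod_def)

section \<open>Speed of the stretched path\<close>

text \<open>Separate velocities \<open>u\<close> before and \<open>v\<close> after time
  \<open>t\<close> treat straight motion and bounces uniformly; \<open>k\<close> is the speed of the
  image path on both sides.\<close>

definition has_stretched_speed ::
  "real \<Rightarrow> real \<Rightarrow> (real \<Rightarrow> complex) \<Rightarrow> real \<Rightarrow> real \<Rightarrow> bool" where
  "has_stretched_speed a b \<gamma> t k \<longleftrightarrow> (\<exists>u v. norm (stretch a b 0 u) = k \<and> norm (stretch a b 0 v) = k \<and>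
     (\<exists>\<epsilon>>0. \<forall>s. 0 \<le> s \<and> s < \<epsilon> \<longrightarrow> \<gamma> (t - s) = \<gamma> t - s *\<^sub>R u \<and> \<gamma> (t + s) = \<gamma> t + s *\<^sub>R v))"

lemma has_stretched_speedI:
  assumes "norm (stretch a b 0 u) = k" "norm (stretch a b 0 v) = k" "\<epsilon> > 0"
    and "\<And>s. 0 \<le> s \<Longrightarrow> s < \<epsilon> \<Longrightarrow> \<gamma> (t - s) = \<gamma> t - s *\<^sub>R u"
    and "\<And>s. 0 \<le> s \<Longrightarrow> s < \<epsilon> \<Longrightarrow> \<gamma> (t + s) = \<gamma> t + s *\<^sub>R v"
  shows "has_stretched_speed a b \<gamma> t k"
  unfolding has_stretched_speed_def using assms by blast

text \<open>The path just after \<open>t\<close> determines the outgoing velocity: any small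
  positive \<open>s\<close> in both intervals gives \<open>v = v'\<close>.\<close>

lemma has_stretched_speed_unique:
  assumes "has_stretched_speed a b \<gamma> t k" "has_stretched_speed a b \<gamma> t k'"
  shows "k = k'"
proof -
  obtain v \<epsilon> where v: "norm (stretch a b 0 v) = k" "\<epsilon> > 0"
      "\<And>s. 0 \<le> s \<Longrightarrow> s < \<epsilon> \<Longrightarrow> \<gamma> (t + s) = \<gamma> t + s *\<^sub>R v"
    using assms(1) unfolding has_stretched_speed_def by blast
  obtain v' \<epsilon>' where v': "norm (stretch a b 0 v') = k'" "\<epsilon>' > 0"
      "\<And>s. 0 \<le> s \<Longrightarrow> s < \<epsilon>' \<Longrightarrow> \<gamma> (t + s) = \<gamma> t + s *\<^sub>R v'"
    using assms(2) unfolding has_stretched_speed_def by blast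
  obtain s where s: "0 < s" "s < \<epsilon>" "s < \<epsilon>'"
    using field_lbound_gt_zero[OF v(2) v'(2)] by blast
  have "s *\<^sub>R v = s *\<^sub>R v'"
    using v(3)[of s] v'(3)[of s] s by simp
  with s have "v = v'" by simp
  with v(1) v'(1) show ?thesis by simp
qed

text \<open>On each side of \<open>t\<close> the path is affine, so a nearby \<open>t'\<close> has
  velocity \<open>v\<close> (if later) or \<open>u\<close> (if earlier) in both time directions, and
  both have stretched norm \<open>k\<close>.\<close>

lemma has_stretched_speed_nearby:
  assumes "has_stretched_speed a b \<gamma> t k"
  shows "\<exists>\<epsilon>>0. \<forall>t'. dist t' t < \<epsilon> \<longrightarrow> has_stretched_speed a b \<gamma> t' k"
proof -
  obtain u v \<epsilon> where uv: "norm (stretch a b 0 u) = k" "norm (stretch a b 0 v) = k" "\<epsilon> > 0"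
      "\<And>s. 0 \<le> s \<Longrightarrow> s < \<epsilon> \<Longrightarrow> \<gamma> (t - s) = \<gamma> t - s *\<^sub>R u"
      "\<And>s. 0 \<le> s \<Longrightarrow> s < \<epsilon> \<Longrightarrow> \<gamma> (t + s) = \<gamma> t + s *\<^sub>R v"
    using assms unfolding has_stretched_speed_def by blast
  have "has_stretched_speed a b \<gamma> t' k" if "dist t' t < \<epsilon>" for t'
  proof -
    consider "t' = t" | "t < t'" | "t' < t" by linarith
    then show ?thesis
    proof cases
      case 1
      with assms show ?thesis by simp
    next
      case 2
      have pos: "\<gamma> r = \<gamma> t + (r - t) *\<^sub>R v" if "t \<le> r" "r < t + \<epsilon>" for r
        using uv(5)[of "r - t"] that by simp
      show ?thesis
        using 2 \<open>dist t' t < \<epsilon>\<close> uv(2)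
        \<comment> \<open>The minimum keeps \<open>t' - s\<close> and \<open>t' + s\<close> between
          \<open>t\<close> and \<open>t + \<epsilon>\<close>, away from a possible bend at
          \<open>t\<close>.\<close>
        by (intro has_stretched_speedI[of a b v k v "min (t' - t) (t + \<epsilon> - t')"])
          (auto simp: dist_real_def pos[of t'] pos[of "s + t'" for s] pos[of "t' - s" for s]
            algebra_simps)
    next
      case 3
      have pos: "\<gamma> r = \<gamma> t - (t - r) *\<^sub>R u" if "r \<le> t" "t - \<epsilon> < r" for r
        using uv(4)[of "t - r"] that by simp
      show ?thesis
        using 3 \<open>dist t' t < \<epsilon>\<close> uv(1)
        by (intro has_stretched_speedI[of a b u k u "min (t - t') (t' - (t - \<epsilon>))"])
          (auto simp: dist_real_def pos[of t'] pos[of "s + t'" for s] pos[of "t' - s" for s]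
            algebra_simps)
    qed
  qed
  with uv(3) show ?thesis by blast
qed

text \<open>By the two preceding lemmas the local speed is a locally constant function of time, and
  the real line is connected.\<close>

lemma has_stretched_speed_constant:
  assumes "\<And>t. \<exists>k. has_stretched_speed a b \<gamma> t k"
  obtains k where "\<And>t. has_stretched_speed a b \<gamma> t k"
proof -
  from assms obtain \<kappa> where \<kappa>: "\<And>t. has_stretched_speed a b \<gamma> t (\<kappa> t)"
    by metis
  have "\<kappa> constant_on UNIV"
  proof (rule locally_constant_imp_constant)
    fix t :: real
    obtain \<epsilon> where \<epsilon>: "\<epsilon> > 0" "\<And>t'. dist t' t < \<epsilon> \<Longrightarrow> has_stretched_speed a b \<gamma> t' (\<kappa> t)"
      using has_stretched_speed_nearby[OF \<kappa>] by blast
    show "\<exists>T. openin (top_of_set UNIV) T \<and> t \<in> T \<and> (\<forall>t'\<in>T. \<kappa> t' = \<kappa> t)"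
    proof (intro exI[of _ "ball t \<epsilon>"] conjI ballI)
      show "\<kappa> t' = \<kappa> t" if "t' \<in> ball t \<epsilon>" for t'
        using that \<epsilon>(2)[of t'] by (intro has_stretched_speed_unique[OF \<kappa>]) (simp add: dist_commute)
    qed (use \<epsilon>(1) in auto)
  qed auto
  then show ?thesis
    using \<kappa> that by (metis constant_on_def UNIV_I)
qed

section \<open>Transport of trajectories and bounce sequences\<close>

text \<open>One inclusion suffices: the inverse of a stretch is a stretch with positive factors, so
  the reverse inclusion is another instance.\<close>

lemma bounce_spectrum_stretch_subset:
  assumes ax: "axis_parallel V" and ab: "0 < a" "0 < b"
  shows "bounce_spectrum V ls \<subseteq> bounce_spectrum (map (stretch a b c) V) ls"
proof
  fix w assume "w \<in> bounce_spectrum V ls"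
  then obtain \<gamma> where nons: "nonsingular_trajectory V \<gamma>" and bs: "bounce_sequence V ls \<gamma> w"
    by (auto simp: bounce_spectrum_def)
  let ?F = "stretch a b c" and ?S = "stretch a b 0"
  let ?V' = "map ?F V"
  have ab0: "a \<noteq> 0" "b \<noteq> 0"
    using ab by auto
  have F_mem: "?F z \<in> ?F ` X \<longleftrightarrow> z \<in> X" for z X
    using inj_stretch[OF ab0] by (rule inj_image_mem_iff)
  have table: "\<gamma> t \<in> table V" and vertex: "\<gamma> t \<notin> set V" for t
    using nons by (auto simp: nonsingular_trajectory_def)
  have dir: "Re (next_vertex V i - V ! i) = 0 \<or> Im (next_vertex V i - V ! i) = 0"
    if "i < length V" for i
    using ax that by (auto simp: axis_parallel_def)
  have nondeg: "next_vertex V i - V ! i \<noteq> 0" if "z \<in> edge_interior V i" for i z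
    using that by (auto simp: edge_interior_def)
  have inner: "\<exists>u. norm u = 1 \<and> (\<exists>\<epsilon>>0. \<forall>s. \<bar>s\<bar> < \<epsilon> \<longrightarrow> \<gamma> (t + s) = \<gamma> t + s *\<^sub>R u)"
    if "\<gamma> t \<in> inside (boundary V)" for t
    using nons that by (simp add: nonsingular_trajectory_def)
  have bounce: "\<exists>u. norm u = 1 \<and> (\<exists>\<epsilon>>0. \<forall>s. 0 \<le> s \<and> s < \<epsilon> \<longrightarrow>
      \<gamma> (t - s) = \<gamma> t - s *\<^sub>R u \<and> \<gamma> (t + s) = \<gamma> t + s *\<^sub>R reflect (next_vertex V i - V ! i) u)"
    if "i < length V" "\<gamma> t \<in> edge_interior V i" for t i
    using nons that by (simp add: nonsingular_trajectory_def)

  \<comment> \<open>Both one-sided velocities are \<open>u\<close>; the instance at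
    \<open>- s\<close> supplies the backward half.\<close>
  have inner_speed: "has_stretched_speed a b \<gamma> t (norm (?S u))"
    if "\<epsilon> > 0" "\<forall>s. \<bar>s\<bar> < \<epsilon> \<longrightarrow> \<gamma> (t + s) = \<gamma> t + s *\<^sub>R u" for t u \<epsilon>
    using that that(2)[rule_format, of "- s" for s]
    by (intro has_stretched_speedI[of a b u _ u \<epsilon>]) auto
  have bounce_speed: "has_stretched_speed a b \<gamma> t (norm (?S u))"
    if "i < length V" "\<gamma> t \<in> edge_interior V i" "\<epsilon> > 0"
      "\<forall>s. 0 \<le> s \<and> s < \<epsilon> \<longrightarrow> \<gamma> (t - s) = \<gamma> t - s *\<^sub>R u \<and>
        \<gamma> (t + s) = \<gamma> t + s *\<^sub>R reflect (next_vertex V i - V ! i) u" for t u \<epsilon> i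
    using that norm_stretch_reflect[OF dir nondeg]
    by (intro has_stretched_speedI[of a b u _ "reflect (next_vertex V i - V ! i) u" \<epsilon>]) auto
  \<comment> \<open>Unit speed excludes \<open>u = 0\<close>, and the linear part is injective. This
    makes the later division by \<open>k\<close> legitimate.\<close>
  have pos: "0 < norm (?S u)" if "norm u = 1" for u
    using that stretch_eq_0_iff[OF ab0, of u] by auto

  have ex_speed: "\<exists>k>0. has_stretched_speed a b \<gamma> t k" for t
  proof (cases "\<gamma> t \<in> inside (boundary V)")
    case True
    with inner inner_speed pos show ?thesis by metis
  next
    case False
    with table have "\<gamma> t \<in> boundary V" by (auto simp: table_def)
    then obtain i where "i < length V" "\<gamma> t \<in> edge_interior V i"
      using boundary_diff_vertices vertex by blast
    with bounce bounce_speed pos show ?thesis by metis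
  qed
  then obtain k where k: "\<And>t. has_stretched_speed a b \<gamma> t k"
    using has_stretched_speed_constant by metis
  have "k > 0"
    using ex_speed k has_stretched_speed_unique by metis

  define \<gamma>' where "\<gamma>' t = ?F (\<gamma> (t / k))" for t
  have bd': "\<gamma>' t \<in> boundary ?V' \<longleftrightarrow> \<gamma> (t / k) \<in> boundary V" for t
    by (simp add: \<gamma>'_def boundary_stretch F_mem)
  have unit: "norm ((1 / k) *\<^sub>R ?S u) = 1" if "norm (?S u) = k" for u
    using that \<open>k > 0\<close> by simp

  have "nonsingular_trajectory ?V' \<gamma>'"
    unfolding nonsingular_trajectory_def
  proof (intro conjI allI impI)
    fix t
    show "\<gamma>' t \<in> table ?V'" "\<gamma>' t \<notin> set ?V'"
      using table vertex by (simp_all add: \<gamma>'_def table_stretch[OF ab0] F_mem)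
  next
    fix t assume "\<gamma>' t \<in> inside (boundary ?V')"
    then have "\<gamma> (t / k) \<in> inside (boundary V)"
      by (simp add: \<gamma>'_def boundary_stretch inside_stretch[OF ab0] F_mem)
    then obtain u \<epsilon> where u: "\<epsilon> > 0" "\<forall>s. \<bar>s\<bar> < \<epsilon> \<longrightarrow> \<gamma> (t / k + s) = \<gamma> (t / k) + s *\<^sub>R u"
      using inner by blast
    \<comment> \<open>The direction \<open>u\<close> depends on the time, but uniqueness identifies
      its stretched norm with the global constant \<open>k\<close>.\<close>
    then have "norm (?S u) = k"
      using inner_speed k has_stretched_speed_unique by blast
    \<comment> \<open>A time step \<open>s\<close> of \<open>\<gamma>'\<close> is a step
      \<open>s / k\<close> of \<open>\<gamma>\<close>, hence the radius
      \<open>k * \<epsilon>\<close>.\<close>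
    moreover have "\<gamma>' (t + s) = \<gamma>' t + s *\<^sub>R (1 / k) *\<^sub>R ?S u" if "\<bar>s\<bar> < k * \<epsilon>" for s
    proof -
      have "\<bar>s / k\<bar> < \<epsilon>"
        using that \<open>k > 0\<close> by (simp add: field_simps)
      then show ?thesis
        using u(2)[rule_format, of "s / k"]
        by (simp add: \<gamma>'_def add_divide_distrib stretch_add_scaleR)
    qed
    ultimately show "\<exists>u. norm u = 1 \<and> (\<exists>\<epsilon>>0. \<forall>s. \<bar>s\<bar> < \<epsilon> \<longrightarrow> \<gamma>' (t + s) = \<gamma>' t + s *\<^sub>R u)"
      using unit u(1) \<open>k > 0\<close>
      by (intro exI[of _ "(1 / k) *\<^sub>R ?S u"] conjI exI[of _ "k * \<epsilon>"]) auto
  next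
    fix t i assume i': "i < length ?V'" "\<gamma>' t \<in> edge_interior ?V' i"
    then have i: "i < length V" "\<gamma> (t / k) \<in> edge_interior V i"
      by (simp_all add: \<gamma>'_def edge_interior_stretch ab0 F_mem)
    let ?d = "next_vertex V i - V ! i"
    obtain u \<epsilon> where u: "\<epsilon> > 0" "\<forall>s. 0 \<le> s \<and> s < \<epsilon> \<longrightarrow> \<gamma> (t / k - s) = \<gamma> (t / k) - s *\<^sub>R u \<and>
        \<gamma> (t / k + s) = \<gamma> (t / k) + s *\<^sub>R reflect ?d u"
      using bounce[OF i] by blast
    then have "norm (?S u) = k"
      using bounce_speed[OF i] k has_stretched_speed_unique by blast
    moreover have "\<gamma>' (t - s) = \<gamma>' t - s *\<^sub>R (1 / k) *\<^sub>R ?S u \<and>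
        \<gamma>' (t + s) = \<gamma>' t + s *\<^sub>R reflect (next_vertex ?V' i - ?V' ! i) ((1 / k) *\<^sub>R ?S u)"
      if "0 \<le> s" "s < k * \<epsilon>" for s
    proof -
      \<comment> \<open>The translation cancels in the edge vector, which becomes
        \<open>?S ?d\<close>; then \<open>reflect_stretch\<close> applies with
        \<open>r = 1 / k\<close>.\<close>
      have "reflect (next_vertex ?V' i - ?V' ! i) ((1 / k) *\<^sub>R ?S u) = (1 / k) *\<^sub>R ?S (reflect ?d u)"
        using i(1) reflect_stretch[OF dir[OF i(1)] nondeg[OF i(2)] ab0]
        by (simp add: next_vertex_map stretch_diff)
      moreover have "0 \<le> s / k" "s / k < \<epsilon>"
        using that \<open>k > 0\<close> by (auto simp: field_simps)
      ultimately show ?thesis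
        using u(2)[rule_format, of "s / k"]
        by (simp add: \<gamma>'_def add_divide_distrib diff_divide_distrib
            stretch_add_scaleR stretch_diff_scaleR)
    qed
    ultimately show "\<exists>u. norm u = 1 \<and> (\<exists>\<epsilon>>0. \<forall>s. 0 \<le> s \<and> s < \<epsilon> \<longrightarrow>
        \<gamma>' (t - s) = \<gamma>' t - s *\<^sub>R u \<and>
        \<gamma>' (t + s) = \<gamma>' t + s *\<^sub>R reflect (next_vertex ?V' i - ?V' ! i) u)"
      using unit u(1) \<open>k > 0\<close>
      by (intro exI[of _ "(1 / k) *\<^sub>R ?S u"] conjI exI[of _ "k * \<epsilon>"]) auto
  qed
  moreover have "bounce_sequence ?V' ls \<gamma>' w"
  proof -
    obtain \<tau> :: "int \<Rightarrow> real" where \<tau>: "strict_mono \<tau>" "range \<tau> = {t. \<gamma> t \<in> boundary V}"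
        "\<tau> (- 1) < 0" "0 \<le> \<tau> 0"
        "\<forall>j. \<exists>i<length V. \<gamma> (\<tau> j) \<in> edge_interior V i \<and> w j = ls ! i"
      using bs unfolding bounce_sequence_def by blast
    \<comment> \<open>Bounce times are multiplied by \<open>k > 0\<close>, which preserves their
      order and signs. Bounce number 0 thus remains the first one at or after the basepoint, and
      \<open>w\<close> needs no shift.\<close>
    have "range (\<lambda>j. k * \<tau> j) = {t. \<gamma>' t \<in> boundary ?V'}"
    proof (intro set_eqI iffI)
      fix t assume "t \<in> {t. \<gamma>' t \<in> boundary ?V'}"
      then have "t / k \<in> range \<tau>"
        by (simp add: bd' \<tau>(2))
      then show "t \<in> range (\<lambda>j. k * \<tau> j)"
        using \<open>k > 0\<close> by (auto simp: field_simps)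
    next
      fix t assume "t \<in> range (\<lambda>j. k * \<tau> j)"
      then show "t \<in> {t. \<gamma>' t \<in> boundary ?V'}"
        using \<tau>(2) \<open>k > 0\<close> by (auto simp: bd')
    qed
    moreover have "\<gamma>' (k * \<tau> j) \<in> edge_interior ?V' i"
      if "i < length V" "\<gamma> (\<tau> j) \<in> edge_interior V i" for i j
      using that \<open>k > 0\<close> by (simp add: \<gamma>'_def edge_interior_stretch ab0)
    ultimately show ?thesis
      unfolding bounce_sequence_def using \<tau>(1,3,4,5) \<open>k > 0\<close>
      by (intro exI[of _ "\<lambda>j. k * \<tau> j"])
        (auto simp: strict_mono_def mult_pos_neg, metis)
  qed
  ultimately show "w \<in> bounce_spectrum ?V' ls"
    by (auto simp: bounce_spectrum_def)
qed

theorem proposition1p6: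
  fixes V V' :: "complex list" and ls :: "'a::finite list" and a b :: real and c :: complex
  assumes "polygon V" and "right_angled V" and "axis_parallel V"
    and "length ls = length V" and "distinct ls"
    and "0 < a" and "0 < b"
    and "V' = map (stretch a b c) V"
  shows "bounce_spectrum V ls = bounce_spectrum V' ls"
proof
  show "bounce_spectrum V ls \<subseteq> bounce_spectrum V' ls"
    using assms by (simp add: bounce_spectrum_stretch_subset)
  \<comment> \<open>The inverse of z |-> Sz + c is z |-> S^{-1}z - S^{-1}c, which gives the
    translation part used here.\<close>
  have "map (stretch (1/a) (1/b) (- stretch (1/a) (1/b) 0 c)) V' = V"
    using assms by (simp add: stretch_inverse o_def)
  then show "bounce_spectrum V' ls \<subseteq> bounce_spectrum V ls"
    using bounce_spectrum_stretch_subset[of V' "1/a" "1/b" ls "- stretch (1/a) (1/b) 0 c"] assms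
    by (simp add: axis_parallel_stretch)
qed

end
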